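(* Let $X$ be a finite indecomposable square-free q-cycle set. Then there exist a set $S$, an irretractable square-free q-cycle set $Y$, and a dynamical pair $(\alpha,\alpha')$ (for $Y$ and $S$) such that $X\cong Y\times_{\alpha,\alpha'}S$.
   Context: A q-cycle set is a non-empty set $X$ with two binary operations $\cdot$ and $:$ such that for every $x\in X$ the map $\sigma_x:X\to X$, $y\mapsto x\cdot y$ is bijective, and for all $x,y,z\in X$: $(x\cdot y)\cdot(x\cdot z)=(y:x)\cdot(y\cdot z)$, $(x:y):(x:z)=(y\cdot x):(y:z)$, and $(x\cdot y):(x\cdot z)=(y:x)\cdot(y:z)$. It is regular if $\delta_x:X\to X$, $y\mapsto x:y$ is bijective for every $x\in X$, and non-degenerate if it is regular and the maps $x\mapsto x\cdot x$ and $x\mapsto x:x$ are bijective (finite regular q-cycle sets are non-degenerate). A non-degenerate q-cycle set is square-free if $x\cdot x=x=x:x$ for all $x$. For a regular q-cycle set, $\mathcal{G}(X)=\langle\sigma_x,\delta_x\mid x\in X\rangle\le\mathrm{Sym}_X$, and $X$ is indecomposable if $X$ is regular and $\mathcal{G}(X)$ acts transitively on $X$. All q-cycle sets are finite. A regular q-cycle set $X$ is retractable if $|X|=1$ or there exist distinct $x,y\in X$ with $\sigma_x=\sigma_y$ and $\delta_x=\delta_y$; otherwise it is irretractable. The symbol $\cong$ denotes isomorphism of q-cycle sets. Given a q-cycle set $Y$, a set $S$, and maps $\alpha:Y\times Y\times S\to\mathrm{Sym}_S$, $\alpha':Y\times Y\times S\to S^S$ (with $S^S$ the set of all maps $S\to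 S$), write $\alpha_{(x,y)}(s,t)$ for the value at $t$ of $\alpha(x,y,s)$, and similarly $\alpha'_{(x,y)}(s,t)$. The pair $(\alpha,\alpha')$ is a dynamical pair if for all $x,y,z\in Y$ and $s,t,u\in S$: $$\alpha_{(x\cdot y,\,x\cdot z)}(\alpha_{(x,y)}(s,t),\alpha_{(x,z)}(s,u))=\alpha_{(y:x,\,y\cdot z)}(\alpha'_{(y,x)}(t,s),\alpha_{(y,z)}(t,u)),$$ $$\alpha'_{(x:y,\,x:z)}(\alpha'_{(x,y)}(s,t),\alpha'_{(x,z)}(s,u))=\alpha'_{(y\cdot x,\,y:z)}(\alpha_{(y,x)}(t,s),\alpha'_{(y,z)}(t,u)),$$ $$\alpha'_{(x\cdot y,\,x\cdot z)}(\alpha_{(x,y)}(s,t),\alpha_{(x,z)}(s,u))=\alpha_{(y:x,\,y:z)}(\alpha'_{(y,x)}(t,s),\alpha'_{(y,z)}(t,u)).$$ Then $Y\times_{\alpha,\alpha'}S$ denotes the q-cycle set on $Y\times S$ with $(x,s)\cdot(y,t):=(x\cdot y,\alpha_{(x,y)}(s,t))$ and $(x,s):(y,t):=(x:y,\alpha'_{(x,y)}(s,t))$.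
   Formalization: X is assumed to have more than one element: for |X| = 1 the claim fails, since X ≅ Y ×_{α,α'} S forces |Y| = 1, and one-element q-cycle sets are retractable by definition. *)

theory Defs
  imports "HOL-Algebra.Group_Action" "HOL-Algebra.Generated_Groups"
begin

section \<open>q-cycle sets\<close>

record 'a qcycle_struct = "'a partial_object" +
  qdot :: "'a \<Rightarrow> 'a \<Rightarrow> 'a"  (infixl \<open>\<cdot>\<index>\<close> 70)
  qcol :: "'a \<Rightarrow> 'a \<Rightarrow> 'a"  (infixl \<open>\<Colon>\<index>\<close> 70)

locale q_cycle_set =
  fixes X (structure)
  assumes nonempty: "carrier X \<noteq> {}"
    and col_closed: "\<lbrakk>x \<in> carrier X; y \<in> carrier X\<rbrakk> \<Longrightarrow> x \<Colon> y \<in> carrier X"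
    and dot_bij: "x \<in> carrier X \<Longrightarrow> bij_betw (\<lambda>y. x \<cdot> y) (carrier X) (carrier X)"
    and q1: "\<lbrakk>x \<in> carrier X; y \<in> carrier X; z \<in> carrier X\<rbrakk>
              \<Longrightarrow> (x \<cdot> y) \<cdot> (x \<cdot> z) = (y \<Colon> x) \<cdot> (y \<cdot> z)"
    and q2: "\<lbrakk>x \<in> carrier X; y \<in> carrier X; z \<in> carrier X\<rbrakk>
              \<Longrightarrow> (x \<Colon> y) \<Colon> (x \<Colon> z) = (y \<cdot> x) \<Colon> (y \<Colon> z)"
    and q3: "\<lbrakk>x \<in> carrier X; y \<in> carrier X; z \<in> carrier X\<rbrakk>
              \<Longrightarrow> (x \<cdot> y) \<Colon> (x \<cdot> z) = (y \<Colon> x) \<cdot> (y \<Colon> z)"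

text \<open>The maps are restricted to the carrier so that they are elements of
  \<^term>\<open>BijGroup (carrier X)\<close> when they are bijective, and so that equality of maps means equality
  on the carrier.\<close>

definition sigma_map :: "('a, 'm) qcycle_struct_scheme \<Rightarrow> 'a \<Rightarrow> 'a \<Rightarrow> 'a" where
  "sigma_map X x = (\<lambda>y\<in>carrier X. x \<cdot>\<^bsub>X\<^esub> y)"

definition delta_map :: "('a, 'm) qcycle_struct_scheme \<Rightarrow> 'a \<Rightarrow> 'a \<Rightarrow> 'a" where
  "delta_map X x = (\<lambda>y\<in>carrier X. x \<Colon>\<^bsub>X\<^esub> y)"

locale regular_q_cycle_set = q_cycle_set +
  assumes col_bij: "x \<in> carrier X \<Longrightarrow> bij_betw (\<lambda>y. x \<Colon> y) (carrier X) (carrier X)"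

locale nondegenerate_q_cycle_set = regular_q_cycle_set +
  assumes dot_square_bij: "bij_betw (\<lambda>x. x \<cdot> x) (carrier X) (carrier X)"
    and col_square_bij: "bij_betw (\<lambda>x. x \<Colon> x) (carrier X) (carrier X)"

locale square_free_q_cycle_set = nondegenerate_q_cycle_set +
  assumes dot_idem: "x \<in> carrier X \<Longrightarrow> x \<cdot> x = x"
    and col_idem: "x \<in> carrier X \<Longrightarrow> x \<Colon> x = x"

definition perm_group :: "('a, 'm) qcycle_struct_scheme \<Rightarrow> ('a \<Rightarrow> 'a) monoid" where
  "perm_group X = (BijGroup (carrier X))
     \<lparr>carrier := generate (BijGroup (carrier X))
                  (sigma_map X ` carrier X \<union> delta_map X ` carrier X)\<rparr>"

lemma (in regular_q_cycle_set) perm_group_action: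
  "group_action (perm_group X) (carrier X) id"
proof -
  interpret B: group "BijGroup (carrier X)" by (rule group_BijGroup)
  have "sigma_map X ` carrier X \<union> delta_map X ` carrier X \<subseteq> carrier (BijGroup (carrier X))"
    using dot_bij col_bij
    by (auto simp: sigma_map_def delta_map_def BijGroup_def Bij_def cong: bij_betw_cong)
  then have "subgroup (generate (BijGroup (carrier X))
      (sigma_map X ` carrier X \<union> delta_map X ` carrier X)) (BijGroup (carrier X))"
    by (rule B.generate_is_subgroup)
  then show ?thesis
    unfolding group_action_def perm_group_def by (rule B.canonical_inj_is_hom)
qed

definition indecomposable :: "('a, 'm) qcycle_struct_scheme \<Rightarrow> bool" where
  "indecomposable X \<longleftrightarrow>
     regular_q_cycle_set X \<and> transitive_action (perm_group X) (carrier X) id"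

text \<open>Singletons are retractable by convention, so an irretractable q-cycle set is never a
  singleton.\<close>

definition retractable :: "('a, 'm) qcycle_struct_scheme \<Rightarrow> bool" where
  "retractable X \<longleftrightarrow> regular_q_cycle_set X \<and>
     (card (carrier X) = 1 \<or>
      (\<exists>x\<in>carrier X. \<exists>y\<in>carrier X. x \<noteq> y \<and>
         sigma_map X x = sigma_map X y \<and> delta_map X x = delta_map X y))"

definition irretractable :: "('a, 'm) qcycle_struct_scheme \<Rightarrow> bool" where
  "irretractable X \<longleftrightarrow> regular_q_cycle_set X \<and> \<not> retractable X"

definition q_cycle_iso :: "('a, 'm) qcycle_struct_scheme \<Rightarrow> ('b, 'n) qcycle_struct_scheme
    \<Rightarrow> ('a \<Rightarrow> 'b) set" where
  "q_cycle_iso X Y = {f. bij_betw f (carrier X) (carrier Y) \<and>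
     (\<forall>x\<in>carrier X. \<forall>y\<in>carrier X.
        f (x \<cdot>\<^bsub>X\<^esub> y) = f x \<cdot>\<^bsub>Y\<^esub> f y \<and> f (x \<Colon>\<^bsub>X\<^esub> y) = f x \<Colon>\<^bsub>Y\<^esub> f y)}"

definition q_cycle_isomorphic :: "('a, 'm) qcycle_struct_scheme \<Rightarrow> ('b, 'n) qcycle_struct_scheme
    \<Rightarrow> bool" (infix \<open>\<cong>\<^sub>q\<close> 50) where
  "X \<cong>\<^sub>q Y \<longleftrightarrow> q_cycle_iso X Y \<noteq> {}"


section \<open>Dynamical extensions\<close>

text \<open>\<open>\<alpha> x y s t\<close> stands for $\alpha_{(x,y)}(s,t)$, the value at \<open>t\<close> of the permutation
  $\alpha(x,y,s)$ of \<open>S\<close>; likewise for \<open>\<alpha>'\<close>, whose values are arbitrary self-maps of \<open>S\<close>.\<close>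

locale dynamical_pair =
  fixes Y (structure) and S :: "'s set"
    and \<alpha> :: "'a \<Rightarrow> 'a \<Rightarrow> 's \<Rightarrow> 's \<Rightarrow> 's" and \<alpha>' :: "'a \<Rightarrow> 'a \<Rightarrow> 's \<Rightarrow> 's \<Rightarrow> 's"
  assumes q_cycle_set: "q_cycle_set Y"
    and \<alpha>_bij: "\<lbrakk>x \<in> carrier Y; y \<in> carrier Y; s \<in> S\<rbrakk> \<Longrightarrow> bij_betw (\<alpha> x y s) S S"
    and \<alpha>'_closed: "\<lbrakk>x \<in> carrier Y; y \<in> carrier Y; s \<in> S\<rbrakk> \<Longrightarrow> \<alpha>' x y s \<in> S \<rightarrow> S"
    and d1: "\<lbrakk>x \<in> carrier Y; y \<in> carrier Y; z \<in> carrier Y; s \<in> S; t \<in> S; u \<in> S\<rbrakk> \<Longrightarrow>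
      \<alpha> (x \<cdot> y) (x \<cdot> z) (\<alpha> x y s t) (\<alpha> x z s u) = \<alpha> (y \<Colon> x) (y \<cdot> z) (\<alpha>' y x t s) (\<alpha> y z t u)"
    and d2: "\<lbrakk>x \<in> carrier Y; y \<in> carrier Y; z \<in> carrier Y; s \<in> S; t \<in> S; u \<in> S\<rbrakk> \<Longrightarrow>
      \<alpha>' (x \<Colon> y) (x \<Colon> z) (\<alpha>' x y s t) (\<alpha>' x z s u) = \<alpha>' (y \<cdot> x) (y \<Colon> z) (\<alpha> y x t s) (\<alpha>' y z t u)"
    and d3: "\<lbrakk>x \<in> carrier Y; y \<in> carrier Y; z \<in> carrier Y; s \<in> S; t \<in> S; u \<in> S\<rbrakk> \<Longrightarrow>
      \<alpha>' (x \<cdot> y) (x \<cdot> z) (\<alpha> x y s t) (\<alpha> x z s u) = \<alpha> (y \<Colon> x) (y \<Colon> z) (\<alpha>' y x t s) (\<alpha>' y z t u)"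

definition dynamical_extension :: "('a, 'm) qcycle_struct_scheme \<Rightarrow> 's set
    \<Rightarrow> ('a \<Rightarrow> 'a \<Rightarrow> 's \<Rightarrow> 's \<Rightarrow> 's) \<Rightarrow> ('a \<Rightarrow> 'a \<Rightarrow> 's \<Rightarrow> 's \<Rightarrow> 's)
    \<Rightarrow> ('a \<times> 's) qcycle_struct" where
  "dynamical_extension Y S \<alpha> \<alpha>' =
     \<lparr>carrier = carrier Y \<times> S,
      qdot = (\<lambda>(x, s) (y, t). (x \<cdot>\<^bsub>Y\<^esub> y, \<alpha> x y s t)),
      qcol = (\<lambda>(x, s) (y, t). (x \<Colon>\<^bsub>Y\<^esub> y, \<alpha>' x y s t))\<rparr>"

lemma (in dynamical_pair) dynamical_extension_q_cycle_set:
  assumes "S \<noteq> {}"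
  shows "q_cycle_set (dynamical_extension Y S \<alpha> \<alpha>')" (is "q_cycle_set ?E")
proof -
  interpret q_cycle_set Y by (rule q_cycle_set)
  have bij: "bij_betw (\<lambda>(y, t). (x \<cdot> y, \<alpha> x y s t)) (carrier Y \<times> S) (carrier Y \<times> S)"
    if x: "x \<in> carrier Y" and s: "s \<in> S" for x s
  proof (rule bij_betw_imageI)
    have a_inj: "inj_on (\<alpha> x y s) S" if "y \<in> carrier Y" for y
      using \<alpha>_bij[OF x that s] by (simp add: bij_betw_def)
    have d_inj: "inj_on (\<lambda>y. x \<cdot> y) (carrier Y)"
      using dot_bij[OF x] by (simp add: bij_betw_def)
    show "inj_on (\<lambda>(y, t). (x \<cdot> y, \<alpha> x y s t)) (carrier Y \<times> S)"
      by (rule inj_onI) (auto dest: inj_onD[OF d_inj] inj_onD[OF a_inj])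
    show "(\<lambda>(y, t). (x \<cdot> y, \<alpha> x y s t)) ` (carrier Y \<times> S) = carrier Y \<times> S"
      (is "?f ` _ = _")
    proof (intro equalityI subsetI)
      fix p assume "p \<in> ?f ` (carrier Y \<times> S)"
      then obtain y t where p: "p = (x \<cdot> y, \<alpha> x y s t)" and y: "y \<in> carrier Y" and t: "t \<in> S"
        by auto
      show "p \<in> carrier Y \<times> S"
        using bij_betw_apply[OF dot_bij[OF x] y] bij_betw_apply[OF \<alpha>_bij[OF x y s] t]
        by (simp add: p)
    next
      fix p assume "p \<in> carrier Y \<times> S"
      then obtain z u where p: "p = (z, u)" and z: "z \<in> carrier Y" and u: "u \<in> S"
        by auto
      from z obtain y where y: "y \<in> carrier Y" "z = x \<cdot> y"
        using bij_betw_imp_surj_on[OF dot_bij[OF x]] by (metis imageE)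
      from u obtain t where t: "t \<in> S" "u = \<alpha> x y s t"
        using bij_betw_imp_surj_on[OF \<alpha>_bij[OF x y(1) s]] by (metis imageE)
      have "p = ?f (y, t)" by (simp add: p y t)
      then show "p \<in> ?f ` (carrier Y \<times> S)" using y(1) t(1) by (rule image_eqI[OF _ SigmaI])
    qed
  qed
  show ?thesis
  proof
    show "carrier ?E \<noteq> {}"
      using nonempty assms by (auto simp: dynamical_extension_def)
  next
    fix p q assume "p \<in> carrier ?E" "q \<in> carrier ?E"
    then show "p \<Colon>\<^bsub>?E\<^esub> q \<in> carrier ?E"
      using col_closed \<alpha>'_closed by (auto simp: dynamical_extension_def Pi_iff)
  next
    fix p assume "p \<in> carrier ?E"
    then show "bij_betw (\<lambda>q. p \<cdot>\<^bsub>?E\<^esub> q) (carrier ?E) (carrier ?E)"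
      using bij by (auto simp: dynamical_extension_def)
  next
    fix p q r assume "p \<in> carrier ?E" "q \<in> carrier ?E" "r \<in> carrier ?E"
    then obtain x s y t z u where
      "p = (x, s)" "q = (y, t)" "r = (z, u)"
      "x \<in> carrier Y" "y \<in> carrier Y" "z \<in> carrier Y" "s \<in> S" "t \<in> S" "u \<in> S"
      by (auto simp: dynamical_extension_def)
    note h = this
    show "(p \<cdot>\<^bsub>?E\<^esub> q) \<cdot>\<^bsub>?E\<^esub> (p \<cdot>\<^bsub>?E\<^esub> r) = (q \<Colon>\<^bsub>?E\<^esub> p) \<cdot>\<^bsub>?E\<^esub> (q \<cdot>\<^bsub>?E\<^esub> r)"
      using q1[OF h(4-6)] d1[OF h(4-9)] by (simp add: h(1-3) dynamical_extension_def)
    show "(p \<Colon>\<^bsub>?E\<^esub> q) \<Colon>\<^bsub>?E\<^esub> (p \<Colon>\<^bsub>?E\<^esub> r) = (q \<cdot>\<^bsub>?E\<^esub> p) \<Colon>\<^bsub>?E\<^esub> (q \<Colon>\<^bsub>?E\<^esub> r)"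
      using q2[OF h(4-6)] d2[OF h(4-9)] by (simp add: h(1-3) dynamical_extension_def)
    show "(p \<cdot>\<^bsub>?E\<^esub> q) \<Colon>\<^bsub>?E\<^esub> (p \<cdot>\<^bsub>?E\<^esub> r) = (q \<Colon>\<^bsub>?E\<^esub> p) \<cdot>\<^bsub>?E\<^esub> (q \<Colon>\<^bsub>?E\<^esub> r)"
      using q3[OF h(4-6)] d3[OF h(4-9)] by (simp add: h(1-3) dynamical_extension_def)
  qed
qed

end

theory Submission
  imports Defs
begin

text \<open>
  Take for \<open>Y\<close> a homomorphic image of \<open>X\<close> of least cardinality among those with more than one
  element. The choice replaces a descent through successive retractions, whose only danger is that
  it might reach a singleton before it stops.

  Such an image is irretractable. Otherwise its retraction is a smaller homomorphic image of \<open>X\<close>,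
  so by minimality it is a singleton: all elements of \<open>Y\<close> act in the same way. In a
  square-free q-cycle set this makes every action trivial, because \<open>x \<cdot> y = y \<cdot> y = y\<close> and likewise
  for the second operation. The epimorphism \<open>X \<rightarrow> Y\<close> is then invariant under all the generators of
  the permutation group of \<open>X\<close>, which is transitive, so \<open>Y\<close> would be a singleton
  (lemma \<open>irretractable_of_minimal\<close>).

  Any homomorphic image of a finite indecomposable \<open>X\<close> presents \<open>X\<close> as a dynamical extension. The
  maps \<open>\<sigma>\<^sub>x\<close> and \<open>\<delta>\<^sub>x\<close> carry fibres bijectively onto fibres, so the size of the fibre through a point
  is again invariant under the generators, hence constant. Identifying all fibres with a single
  set \<open>S\<close> turns the two operations of \<open>X\<close> into \<open>\<alpha>\<close> and \<open>\<alpha>'\<close>, and the equations of a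
  dynamical pair are the equations of \<open>X\<close> read through this identification
  (lemma \<open>dynamical_extension_of_equicardinal_fibres\<close>).
\<close>

section \<open>Homomorphic images\<close>

definition q_cycle_epi :: "('a, 'm) qcycle_struct_scheme \<Rightarrow> ('b, 'n) qcycle_struct_scheme
    \<Rightarrow> ('a \<Rightarrow> 'b) set" where
  "q_cycle_epi X Y = {f. f ` carrier X = carrier Y \<and>
     (\<forall>x\<in>carrier X. \<forall>y\<in>carrier X.
        f (x \<cdot>\<^bsub>X\<^esub> y) = f x \<cdot>\<^bsub>Y\<^esub> f y \<and> f (x \<Colon>\<^bsub>X\<^esub> y) = f x \<Colon>\<^bsub>Y\<^esub> f y)}"

lemma q_cycle_epiD:
  assumes "f \<in> q_cycle_epi X Y"
  shows "f ` carrier X = carrier Y"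
    and "x \<in> carrier X \<Longrightarrow> f x \<in> carrier Y"
    and "\<lbrakk>x \<in> carrier X; y \<in> carrier X\<rbrakk> \<Longrightarrow> f (x \<cdot>\<^bsub>X\<^esub> y) = f x \<cdot>\<^bsub>Y\<^esub> f y"
    and "\<lbrakk>x \<in> carrier X; y \<in> carrier X\<rbrakk> \<Longrightarrow> f (x \<Colon>\<^bsub>X\<^esub> y) = f x \<Colon>\<^bsub>Y\<^esub> f y"
  using assms by (auto simp: q_cycle_epi_def)

lemma q_cycle_epi_id: "(\<lambda>x. x) \<in> q_cycle_epi X X"
  by (simp add: q_cycle_epi_def)

lemma q_cycle_epi_comp:
  assumes f: "f \<in> q_cycle_epi X Y" and g: "g \<in> q_cycle_epi Y Z"
  shows "g \<circ> f \<in> q_cycle_epi X Z"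
proof -
  have "(g \<circ> f) ` carrier X = carrier Z"
    by (simp only: image_comp[symmetric] q_cycle_epiD(1)[OF f] q_cycle_epiD(1)[OF g])
  then show ?thesis
    by (simp add: q_cycle_epi_def q_cycle_epiD[OF f] q_cycle_epiD[OF g])
qed

lemma (in q_cycle_set) dot_closed:
  "\<lbrakk>x \<in> carrier X; y \<in> carrier X\<rbrakk> \<Longrightarrow> x \<cdot> y \<in> carrier X"
  using dot_bij bij_betw_apply by fastforce

lemma (in q_cycle_set) dot_cancel:
  "\<lbrakk>x \<in> carrier X; y \<in> carrier X; z \<in> carrier X\<rbrakk> \<Longrightarrow> x \<cdot> y = x \<cdot> z \<longleftrightarrow> y = z"
  using dot_bij[of x] by (auto simp: bij_betw_def dest: inj_onD)

lemma (in q_cycle_set) dot_solvable: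
  assumes "x \<in> carrier X" "w \<in> carrier X"
  obtains y where "y \<in> carrier X" "w = x \<cdot> y"
  using assms dot_bij[of x] by (metis bij_betw_imp_surj_on imageE)

lemma (in regular_q_cycle_set) col_cancel:
  "\<lbrakk>x \<in> carrier X; y \<in> carrier X; z \<in> carrier X\<rbrakk> \<Longrightarrow> x \<Colon> y = x \<Colon> z \<longleftrightarrow> y = z"
  using col_bij[of x] by (auto simp: bij_betw_def dest: inj_onD)

lemma (in regular_q_cycle_set) col_solvable:
  assumes "x \<in> carrier X" "w \<in> carrier X"
  obtains y where "y \<in> carrier X" "w = x \<Colon> y"
  using assms col_bij[of x] by (metis bij_betw_imp_surj_on imageE)

text \<open>Equations pass to any homomorphic image, and so does the surjectivity of translations;
  finiteness then makes the translations of the image bijective.\<close>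

lemma square_free_epi_image:
  fixes X (structure)
  assumes sf: "square_free_q_cycle_set X" and fin: "finite (carrier X)"
    and f: "f \<in> q_cycle_epi X Y"
  shows "square_free_q_cycle_set Y"
proof -
  interpret square_free_q_cycle_set X by (rule sf)
  note fD = q_cycle_epiD[OF f]
  have preim: "\<exists>a\<in>carrier X. y = f a" if "y \<in> carrier Y" for y
    using that fD(1) by (metis imageE)
  have finY: "finite (carrier Y)" using fin fD(1) by (metis finite_imageI)
  have bij: "bij_betw g (carrier Y) (carrier Y)" if "g ` carrier Y = carrier Y" for g
    using that finY by (simp add: bij_betw_def eq_card_imp_inj_on)
  have dot_image: "(\<lambda>y. f a \<cdot>\<^bsub>Y\<^esub> y) ` carrier Y = carrier Y" if a: "a \<in> carrier X" for a
  proof -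
    have "(\<lambda>y. f a \<cdot>\<^bsub>Y\<^esub> y) ` f ` carrier X = f ` (\<lambda>b. a \<cdot> b) ` carrier X"
      using a by (simp add: image_image fD(3))
    then show ?thesis using bij_betw_imp_surj_on[OF dot_bij[OF a]] fD(1) by simp
  qed
  have col_image: "(\<lambda>y. f a \<Colon>\<^bsub>Y\<^esub> y) ` carrier Y = carrier Y" if a: "a \<in> carrier X" for a
  proof -
    have "(\<lambda>y. f a \<Colon>\<^bsub>Y\<^esub> y) ` f ` carrier X = f ` (\<lambda>b. a \<Colon> b) ` carrier X"
      using a by (simp add: image_image fD(4))
    then show ?thesis using bij_betw_imp_surj_on[OF col_bij[OF a]] fD(1) by simp
  qed
  have didem: "x \<cdot>\<^bsub>Y\<^esub> x = x" if x: "x \<in> carrier Y" for x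
    using preim[OF x] dot_idem fD(3) by metis
  have cidem: "x \<Colon>\<^bsub>Y\<^esub> x = x" if x: "x \<in> carrier Y" for x
    using preim[OF x] col_idem fD(4) by metis
  show ?thesis
  proof
    show "carrier Y \<noteq> {}" using nonempty fD(1) by blast
  next
    fix x y assume "x \<in> carrier Y" "y \<in> carrier Y"
    then show "x \<Colon>\<^bsub>Y\<^esub> y \<in> carrier Y" using preim col_image by blast
  next
    fix x assume "x \<in> carrier Y"
    then obtain a where a: "a \<in> carrier X" "x = f a" using preim by blast
    show "bij_betw (\<lambda>y. x \<cdot>\<^bsub>Y\<^esub> y) (carrier Y) (carrier Y)"
      and "bij_betw (\<lambda>y. x \<Colon>\<^bsub>Y\<^esub> y) (carrier Y) (carrier Y)"
      using bij[OF dot_image[OF a(1)]] bij[OF col_image[OF a(1)]] by (simp_all add: a(2))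
  next
    fix x y z assume "x \<in> carrier Y" "y \<in> carrier Y" "z \<in> carrier Y"
    then obtain a b c where
      abc: "a \<in> carrier X" "b \<in> carrier X" "c \<in> carrier X" and [simp]: "x = f a" "y = f b" "z = f c"
      using preim by meson
    note s = abc dot_closed col_closed fD(3,4)[symmetric]
    show "(x \<cdot>\<^bsub>Y\<^esub> y) \<cdot>\<^bsub>Y\<^esub> (x \<cdot>\<^bsub>Y\<^esub> z) = (y \<Colon>\<^bsub>Y\<^esub> x) \<cdot>\<^bsub>Y\<^esub> (y \<cdot>\<^bsub>Y\<^esub> z)"
      using q1[OF abc] by (simp add: s)
    show "(x \<Colon>\<^bsub>Y\<^esub> y) \<Colon>\<^bsub>Y\<^esub> (x \<Colon>\<^bsub>Y\<^esub> z) = (y \<cdot>\<^bsub>Y\<^esub> x) \<Colon>\<^bsub>Y\<^esub> (y \<Colon>\<^bsub>Y\<^esub> z)"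
      using q2[OF abc] by (simp add: s)
    show "(x \<cdot>\<^bsub>Y\<^esub> y) \<Colon>\<^bsub>Y\<^esub> (x \<cdot>\<^bsub>Y\<^esub> z) = (y \<Colon>\<^bsub>Y\<^esub> x) \<cdot>\<^bsub>Y\<^esub> (y \<Colon>\<^bsub>Y\<^esub> z)"
      using q3[OF abc] by (simp add: s)
  next
    show "bij_betw (\<lambda>x. x \<cdot>\<^bsub>Y\<^esub> x) (carrier Y) (carrier Y)"
      and "bij_betw (\<lambda>x. x \<Colon>\<^bsub>Y\<^esub> x) (carrier Y) (carrier Y)"
      by (auto intro: bij simp: didem cidem)
  qed (use didem cidem in auto)
qed


section \<open>The retraction\<close>

definition same_action :: "('a, 'm) qcycle_struct_scheme \<Rightarrow> 'a \<Rightarrow> 'a \<Rightarrow> bool" where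
  "same_action X x y \<longleftrightarrow> sigma_map X x = sigma_map X y \<and> delta_map X x = delta_map X y"

lemma same_action_iff:
  "same_action X x y \<longleftrightarrow> (\<forall>z\<in>carrier X. x \<cdot>\<^bsub>X\<^esub> z = y \<cdot>\<^bsub>X\<^esub> z \<and> x \<Colon>\<^bsub>X\<^esub> z = y \<Colon>\<^bsub>X\<^esub> z)"
  by (auto simp: same_action_def sigma_map_def delta_map_def restrict_def fun_eq_iff)

text \<open>Written with translations, the axioms express each of \<open>\<sigma>\<^bsub>x\<cdot>y\<^esub> \<sigma>\<^sub>x\<close>, \<open>\<delta>\<^bsub>x\<cdot>y\<^esub> \<sigma>\<^sub>x\<close>,
  \<open>\<sigma>\<^bsub>x\<Colon>y\<^esub> \<delta>\<^sub>x\<close> and \<open>\<delta>\<^bsub>x\<Colon>y\<^esub> \<delta>\<^sub>x\<close> through \<open>x\<close> and the action of \<open>y\<close> alone. Since \<open>\<sigma>\<^sub>x\<close> and \<open>\<delta>\<^sub>x\<close> are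
  onto, the actions of \<open>x \<cdot> y\<close> and \<open>x \<Colon> y\<close> depend on \<open>y\<close> only through its action.\<close>

lemma (in regular_q_cycle_set) same_action_cong:
  assumes x: "x \<in> carrier X" and y: "y \<in> carrier X" and y': "y' \<in> carrier X"
    and eq: "same_action X y y'"
  shows "same_action X (x \<cdot> y) (x \<cdot> y')" and "same_action X (x \<Colon> y) (x \<Colon> y')"
proof -
  have e: "y \<cdot> z = y' \<cdot> z" "y \<Colon> z = y' \<Colon> z" if "z \<in> carrier X" for z
    using eq that by (auto simp: same_action_iff)
  show "same_action X (x \<cdot> y) (x \<cdot> y')"
    unfolding same_action_iff
  proof
    fix w assume "w \<in> carrier X"
    then obtain z where z: "z \<in> carrier X" and w: "w = x \<cdot> z" using dot_solvable x by blast
    show "(x \<cdot> y) \<cdot> w = (x \<cdot> y') \<cdot> w \<and> (x \<cdot> y) \<Colon> w = (x \<cdot> y') \<Colon> w"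
      using q1[OF x y z] q1[OF x y' z] q3[OF x y z] q3[OF x y' z] e[OF x] e[OF z]
      unfolding w by metis
  qed
  show "same_action X (x \<Colon> y) (x \<Colon> y')"
    unfolding same_action_iff
  proof
    fix w assume "w \<in> carrier X"
    then obtain z where z: "z \<in> carrier X" and w: "w = x \<Colon> z" using col_solvable x by blast
    show "(x \<Colon> y) \<cdot> w = (x \<Colon> y') \<cdot> w \<and> (x \<Colon> y) \<Colon> w = (x \<Colon> y') \<Colon> w"
      \<comment> \<open>The third axiom is used with its first two arguments exchanged.\<close>
      using q2[OF x y z] q2[OF x y' z] q3[OF y x z] q3[OF y' x z] e[OF x] e[OF z]
      unfolding w by metis
  qed
qed

definition action_rep :: "('a, 'm) qcycle_struct_scheme \<Rightarrow> 'a \<Rightarrow> 'a" where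
  "action_rep X x = (SOME y. y \<in> carrier X \<and> same_action X x y)"

lemma action_rep:
  assumes "x \<in> carrier X"
  shows "action_rep X x \<in> carrier X" and "same_action X x (action_rep X x)"
proof -
  have "action_rep X x \<in> carrier X \<and> same_action X x (action_rep X x)"
    unfolding action_rep_def by (rule someI[of _ x]) (simp add: assms same_action_def)
  then show "action_rep X x \<in> carrier X" and "same_action X x (action_rep X x)" by auto
qed

lemma action_rep_eq: "same_action X x y \<Longrightarrow> action_rep X x = action_rep X y"
  by (simp add: action_rep_def same_action_def)

text \<open>The elements are representatives of the classes rather than the classes themselves, so that
  repeated retraction stays within one type.\<close>

definition retraction :: "('a, 'm) qcycle_struct_scheme \<Rightarrow> 'a qcycle_struct" where
  "retraction X = \<lparr>carrier = action_rep X ` carrier X,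
     qdot = (\<lambda>x y. action_rep X (x \<cdot>\<^bsub>X\<^esub> y)),
     qcol = (\<lambda>x y. action_rep X (x \<Colon>\<^bsub>X\<^esub> y))\<rparr>"

lemma (in regular_q_cycle_set) action_rep_epi: "action_rep X \<in> q_cycle_epi X (retraction X)"
proof -
  have "action_rep X (x \<cdot> y) = action_rep X (action_rep X x \<cdot> action_rep X y) \<and>
        action_rep X (x \<Colon> y) = action_rep X (action_rep X x \<Colon> action_rep X y)"
    if x: "x \<in> carrier X" and y: "y \<in> carrier X" for x y
  proof -
    note rx = action_rep[OF x] and ry = action_rep[OF y]
    have "x \<cdot> y = action_rep X x \<cdot> y" "x \<Colon> y = action_rep X x \<Colon> y"
      using rx(2) y by (auto simp: same_action_iff)
    then show ?thesis
      using same_action_cong[OF rx(1) y ry] by (auto intro: action_rep_eq)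
  qed
  then show ?thesis by (simp add: q_cycle_epi_def retraction_def)
qed

lemma card_retraction_less:
  assumes fin: "finite (carrier X)" and x: "x \<in> carrier X" and y: "y \<in> carrier X"
    and "x \<noteq> y" and "same_action X x y"
  shows "card (carrier (retraction X)) < card (carrier X)"
proof -
  have "\<not> inj_on (action_rep X) (carrier X)"
    using assms action_rep_eq[of X x y] by (auto dest: inj_onD)
  then have "card (action_rep X ` carrier X) \<noteq> card (carrier X)"
    using fin eq_card_imp_inj_on by blast
  then show ?thesis
    using card_image_le[OF fin, of "action_rep X"] by (simp add: retraction_def)
qed

text \<open>A singleton retraction means that all elements act alike, and in a square-free q-cycle set \<open>y\<close>
  itself fixes \<open>y\<close>.\<close>

lemma (in square_free_q_cycle_set) trivial_action_if_retraction_singleton: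
  assumes "card (carrier (retraction X)) = 1" and x: "x \<in> carrier X" and y: "y \<in> carrier X"
  shows "x \<cdot> y = y" and "x \<Colon> y = y"
proof -
  from assms(1) have "action_rep X x = action_rep X y"
    using x y by (metis q_cycle_epiD(2)[OF action_rep_epi] card_1_singletonE singletonD)
  then have "same_action X x y"
    using action_rep(2)[OF x] action_rep(2)[OF y] by (simp add: same_action_def)
  then show "x \<cdot> y = y" and "x \<Colon> y = y"
    using dot_idem[OF y] col_idem[OF y] y by (auto simp: same_action_iff)
qed


section \<open>Indecomposability\<close>

text \<open>The permutations that preserve \<open>c\<close> form a group that contains all \<open>\<sigma>\<^sub>x\<close> and \<open>\<delta>\<^sub>x\<close>, hence also
  the transitive permutation group of \<open>X\<close>. Indecomposability is used only through this lemma: with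
  \<open>c\<close> an epimorphism onto a q-cycle set with trivial actions, and with \<open>c\<close> the size of a fibre.\<close>

lemma indecomposable_invariant_constant:
  fixes X (structure)
  assumes ind: "indecomposable X"
    and dot: "\<And>x y. \<lbrakk>x \<in> carrier X; y \<in> carrier X\<rbrakk> \<Longrightarrow> c (x \<cdot> y) = c y"
    and col: "\<And>x y. \<lbrakk>x \<in> carrier X; y \<in> carrier X\<rbrakk> \<Longrightarrow> c (x \<Colon> y) = c y"
    and x: "x \<in> carrier X" and y: "y \<in> carrier X"
  shows "c x = c y"
proof -
  interpret regular_q_cycle_set X using ind by (simp add: indecomposable_def)
  let ?B = "BijGroup (carrier X)"
  let ?gens = "sigma_map X ` carrier X \<union> delta_map X ` carrier X"
  interpret B: group ?B by (rule group_BijGroup)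
  have gens: "?gens \<subseteq> Bij (carrier X)"
    using dot_bij col_bij
    by (auto simp: sigma_map_def delta_map_def Bij_def cong: bij_betw_cong)
  have gens_inv: "c (g z) = c z" if "g \<in> ?gens" "z \<in> carrier X" for g z
    using that dot col by (auto simp: sigma_map_def delta_map_def)
  have inv: "g \<in> Bij (carrier X) \<and> (\<forall>z\<in>carrier X. c (g z) = c z)"
    if "g \<in> generate ?B ?gens" for g
    using that
  proof induction
    case one
    show ?case using id_Bij[of "carrier X"] by (simp add: BijGroup_def restrict_def)
  next
    case (incl h)
    then show ?case using gens gens_inv by blast
  next
    case (inv h)
    then have h: "h \<in> Bij (carrier X)" using gens by blast
    have "c (inv_into (carrier X) h z) = c z" if z: "z \<in> carrier X" for z
    proof -
      have "h ` carrier X = carrier X" using h by (simp add: Bij_def bij_betw_def)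
      then have "inv_into (carrier X) h z \<in> carrier X" "h (inv_into (carrier X) h z) = z"
        using z by (auto intro: inv_into_into f_inv_into_f)
      then show ?thesis using gens_inv[OF inv] by metis
    qed
    then show ?case
      using h restrict_inv_into_Bij[OF h] by (simp add: inv_BijGroup restrict_def)
  next
    case (eng g h)
    then show ?case
      using Bij_imp_funcset[of h "carrier X"] compose_Bij[of g "carrier X" h]
      by (auto simp: BijGroup_def compose_def restrict_def Pi_iff)
  qed
  interpret transitive_action "perm_group X" "carrier X" id
    using ind by (simp add: indecomposable_def)
  obtain g where "g \<in> carrier (perm_group X)" "g x = y"
    using unique_orbit[OF x y] by auto
  then show ?thesis using inv[of g] x by (auto simp: perm_group_def)
qed

text \<open>Two elements with the same action would make the retraction a smaller image, so a singleton by
  minimality. The actions on \<open>Y\<close> are then trivial, which makes \<open>f\<close> itself an invariant of \<open>X\<close>.\<close>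

lemma irretractable_of_minimal:
  assumes ind: "indecomposable X" and f: "f \<in> q_cycle_epi X Y"
    and fin: "finite (carrier Y)" and sf: "square_free_q_cycle_set Y"
    and card: "card (carrier Y) > 1"
    and minimal: "\<And>g. g \<in> q_cycle_epi X (retraction Y) \<Longrightarrow> card (carrier (retraction Y)) > 1
      \<Longrightarrow> card (carrier Y) \<le> card (carrier (retraction Y))"
  shows "irretractable Y"
proof -
  interpret Y: square_free_q_cycle_set Y by (rule sf)
  have "\<not> same_action Y x y"
    if xy: "x \<in> carrier Y" "y \<in> carrier Y" "x \<noteq> y" for x y
  proof
    assume "same_action Y x y"
    then have "card (carrier (retraction Y)) < card (carrier Y)"
      using card_retraction_less[OF fin] xy by blast
    moreover have "card (carrier (retraction Y)) > 0"
      using fin Y.nonempty by (simp add: retraction_def card_gt_0_iff)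
    ultimately have one: "card (carrier (retraction Y)) = 1"
      using minimal[OF q_cycle_epi_comp[OF f Y.action_rep_epi]] by linarith
    note triv = Y.trivial_action_if_retraction_singleton[OF one]
    obtain a b where "a \<in> carrier X" "b \<in> carrier X" "x = f a" "y = f b"
      using xy q_cycle_epiD(1)[OF f] by (metis imageE)
    moreover have "f a = f b" if "a \<in> carrier X" "b \<in> carrier X" for a b
      using ind _ _ that
      by (rule indecomposable_invariant_constant) (simp_all add: q_cycle_epiD[OF f] triv)
    ultimately show False using xy by blast
  qed
  then have "\<not> retractable Y"
    using card by (auto simp: retractable_def same_action_def)
  then show ?thesis
    unfolding irretractable_def using Y.regular_q_cycle_set_axioms by blast
qed


section \<open>Epimorphisms as dynamical extensions\<close>

text \<open>A translation is injective on each fibre, and because the translation of the image is also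
  injective, nothing outside the fibre reaches the target fibre.\<close>

lemma dot_bij_fibre:
  assumes X: "q_cycle_set X" and Y: "q_cycle_set Y" and f: "f \<in> q_cycle_epi X Y"
    and a: "a \<in> carrier X" and y: "y \<in> carrier Y"
  shows "bij_betw (\<lambda>b. a \<cdot>\<^bsub>X\<^esub> b) {b \<in> carrier X. f b = y} {b \<in> carrier X. f b = f a \<cdot>\<^bsub>Y\<^esub> y}"
    (is "bij_betw ?s ?F ?F'")
proof (rule bij_betw_imageI)
  interpret X: q_cycle_set X by (rule X)
  interpret Y: q_cycle_set Y by (rule Y)
  note fD = q_cycle_epiD[OF f]
  show "inj_on ?s ?F" by (rule inj_onI) (use a X.dot_cancel in auto)
  show "?s ` ?F = ?F'"
  proof (intro equalityI subsetI)
    fix c assume "c \<in> ?F'"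
    then obtain b where b: "b \<in> carrier X" "c = a \<cdot>\<^bsub>X\<^esub> b" "f c = f a \<cdot>\<^bsub>Y\<^esub> y"
      using a X.dot_solvable[of a c] by blast
    then have "f b = y" using a y fD Y.dot_cancel by metis
    then show "c \<in> ?s ` ?F" using b by blast
  qed (use a fD(3) X.dot_closed in auto)
qed

lemma col_bij_fibre:
  assumes X: "regular_q_cycle_set X" and Y: "regular_q_cycle_set Y" and f: "f \<in> q_cycle_epi X Y"
    and a: "a \<in> carrier X" and y: "y \<in> carrier Y"
  shows "bij_betw (\<lambda>b. a \<Colon>\<^bsub>X\<^esub> b) {b \<in> carrier X. f b = y} {b \<in> carrier X. f b = f a \<Colon>\<^bsub>Y\<^esub> y}"
    (is "bij_betw ?d ?F ?F'")
proof (rule bij_betw_imageI)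
  interpret X: regular_q_cycle_set X by (rule X)
  interpret Y: regular_q_cycle_set Y by (rule Y)
  note fD = q_cycle_epiD[OF f]
  show "inj_on ?d ?F" by (rule inj_onI) (use a X.col_cancel in auto)
  show "?d ` ?F = ?F'"
  proof (intro equalityI subsetI)
    fix c assume "c \<in> ?F'"
    then obtain b where b: "b \<in> carrier X" "c = a \<Colon>\<^bsub>X\<^esub> b" "f c = f a \<Colon>\<^bsub>Y\<^esub> y"
      using a X.col_solvable[of a c] by blast
    then have "f b = y" using a y fD Y.col_cancel by metis
    then show "c \<in> ?d ` ?F" using b by blast
  qed (use a fD(4) X.col_closed in auto)
qed

lemma indecomposable_fibres_equicardinal:
  assumes ind: "indecomposable X" and Y: "regular_q_cycle_set Y"
    and f: "f \<in> q_cycle_epi X Y"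
    and x: "x \<in> carrier X" and y: "y \<in> carrier X"
  shows "card {a \<in> carrier X. f a = f x} = card {a \<in> carrier X. f a = f y}"
proof -
  interpret X: regular_q_cycle_set X using ind by (simp add: indecomposable_def)
  interpret Y: regular_q_cycle_set Y by (rule Y)
  note fD = q_cycle_epiD[OF f]
  show ?thesis
  proof (rule indecomposable_invariant_constant[where c = "\<lambda>x. card {a \<in> carrier X. f a = f x}",
        OF ind _ _ x y])
    fix p q assume p: "p \<in> carrier X" and q: "q \<in> carrier X"
    show "card {a \<in> carrier X. f a = f (p \<cdot>\<^bsub>X\<^esub> q)} = card {a \<in> carrier X. f a = f q}"
      using bij_betw_same_card[OF dot_bij_fibre[OF X.q_cycle_set_axioms Y.q_cycle_set_axioms f p
          fD(2)[OF q]]]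
      by (simp add: fD(3)[OF p q])
    show "card {a \<in> carrier X. f a = f (p \<Colon>\<^bsub>X\<^esub> q)} = card {a \<in> carrier X. f a = f q}"
      using bij_betw_same_card[OF col_bij_fibre[OF X.regular_q_cycle_set_axioms Y f p fD(2)[OF q]]]
      by (simp add: fD(4)[OF p q])
  qed
qed

text \<open>The identifications \<open>b y\<close> of the fibres with \<open>S\<close> may be chosen arbitrarily and independently:
  changing them only replaces the dynamical pair by an equivalent one. The values of \<open>\<alpha>\<close> are
  permutations because \<open>\<sigma>\<^sub>x\<close> maps fibres bijectively onto fibres, and each equation of a dynamical
  pair is the second coordinate of an axiom of \<open>X\<close>.\<close>

lemma dynamical_extension_of_equicardinal_fibres:
  assumes X: "q_cycle_set X" and Y: "q_cycle_set Y" and f: "f \<in> q_cycle_epi X Y"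
    and b: "\<And>y. y \<in> carrier Y \<Longrightarrow> bij_betw (b y) {a \<in> carrier X. f a = y} S"
  shows "\<exists>\<alpha> \<alpha>'. dynamical_pair Y S \<alpha> \<alpha>' \<and> X \<cong>\<^sub>q dynamical_extension Y S \<alpha> \<alpha>'"
proof -
  interpret X: q_cycle_set X by (rule X)
  interpret Y: q_cycle_set Y by (rule Y)
  note fD = q_cycle_epiD[OF f]
  define e where "e y = inv_into {a \<in> carrier X. f a = y} (b y)" for y
  define \<alpha> where "\<alpha> x y s t = b (x \<cdot>\<^bsub>Y\<^esub> y) (e x s \<cdot>\<^bsub>X\<^esub> e y t)" for x y s t
  define \<alpha>' where "\<alpha>' x y s t = b (x \<Colon>\<^bsub>Y\<^esub> y) (e x s \<Colon>\<^bsub>X\<^esub> e y t)" for x y s t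
  have e_bij: "bij_betw (e y) S {a \<in> carrier X. f a = y}" if "y \<in> carrier Y" for y
    unfolding e_def using b[OF that] by (rule bij_betw_inv_into)
  have e: "e y s \<in> carrier X" "f (e y s) = y" if "y \<in> carrier Y" "s \<in> S" for y s
    using bij_betw_apply[OF e_bij[OF that(1)] that(2)] by auto
  have eb: "e (f a) (b (f a) a) = a" if "a \<in> carrier X" for a
    unfolding e_def using b[OF fD(2)[OF that]] that by (simp add: bij_betw_def inv_into_f_f)
  have bS: "b (f a) a \<in> S" if "a \<in> carrier X" for a
    using bij_betw_apply[OF b[OF fD(2)[OF that]]] that by simp
  have e\<alpha>: "e (x \<cdot>\<^bsub>Y\<^esub> y) (\<alpha> x y s t) = e x s \<cdot>\<^bsub>X\<^esub> e y t"
    and e\<alpha>': "e (x \<Colon>\<^bsub>Y\<^esub> y) (\<alpha>' x y s t) = e x s \<Colon>\<^bsub>X\<^esub> e y t"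
    if "x \<in> carrier Y" "y \<in> carrier Y" "s \<in> S" "t \<in> S" for x y s t
    using eb[of "e x s \<cdot>\<^bsub>X\<^esub> e y t"] eb[of "e x s \<Colon>\<^bsub>X\<^esub> e y t"] that
    by (simp_all add: \<alpha>_def \<alpha>'_def e fD X.dot_closed X.col_closed)
  have pair: "dynamical_pair Y S \<alpha> \<alpha>'"
  proof
    fix x y s assume h: "x \<in> carrier Y" "y \<in> carrier Y" "s \<in> S"
    note es = e[OF h(1,3)]
    have "bij_betw (b (x \<cdot>\<^bsub>Y\<^esub> y) \<circ> ((\<lambda>a. e x s \<cdot>\<^bsub>X\<^esub> a) \<circ> e y)) S S"
      using dot_bij_fibre[OF X Y f es(1) h(2)] b[OF Y.dot_closed[OF h(1,2)]] e_bij[OF h(2)]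
      by (auto intro!: bij_betw_trans simp: es(2))
    then show "bij_betw (\<alpha> x y s) S S"
      unfolding \<alpha>_def comp_def .
    show "\<alpha>' x y s \<in> S \<rightarrow> S"
    proof
      fix t assume t: "t \<in> S"
      show "\<alpha>' x y s t \<in> S"
        using bS[of "e x s \<Colon>\<^bsub>X\<^esub> e y t"] h t by (simp add: \<alpha>'_def e fD X.col_closed)
    qed
  next
    fix x y z s t u
    assume h: "x \<in> carrier Y" "y \<in> carrier Y" "z \<in> carrier Y" "s \<in> S" "t \<in> S" "u \<in> S"
    note q = h(1-3) e(1)[OF h(1,4)] e(1)[OF h(2,5)] e(1)[OF h(3,6)]
    \<comment> \<open>Only the outer \<open>\<alpha>\<close> or \<open>\<alpha>'\<close> is unfolded; the inner ones cancel against \<open>e\<close>.\<close>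
    show "\<alpha> (x \<cdot>\<^bsub>Y\<^esub> y) (x \<cdot>\<^bsub>Y\<^esub> z) (\<alpha> x y s t) (\<alpha> x z s u) =
        \<alpha> (y \<Colon>\<^bsub>Y\<^esub> x) (y \<cdot>\<^bsub>Y\<^esub> z) (\<alpha>' y x t s) (\<alpha> y z t u)"
      using X.q1[OF q(4-6)] Y.q1[OF q(1-3)]
      unfolding \<alpha>_def[of "x \<cdot>\<^bsub>Y\<^esub> y" "x \<cdot>\<^bsub>Y\<^esub> z"] \<alpha>_def[of "y \<Colon>\<^bsub>Y\<^esub> x" "y \<cdot>\<^bsub>Y\<^esub> z"]
      by (simp add: e\<alpha> e\<alpha>' h)
    show "\<alpha>' (x \<Colon>\<^bsub>Y\<^esub> y) (x \<Colon>\<^bsub>Y\<^esub> z) (\<alpha>' x y s t) (\<alpha>' x z s u) =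
        \<alpha>' (y \<cdot>\<^bsub>Y\<^esub> x) (y \<Colon>\<^bsub>Y\<^esub> z) (\<alpha> y x t s) (\<alpha>' y z t u)"
      using X.q2[OF q(4-6)] Y.q2[OF q(1-3)]
      unfolding \<alpha>'_def[of "x \<Colon>\<^bsub>Y\<^esub> y" "x \<Colon>\<^bsub>Y\<^esub> z"] \<alpha>'_def[of "y \<cdot>\<^bsub>Y\<^esub> x" "y \<Colon>\<^bsub>Y\<^esub> z"]
      by (simp add: e\<alpha> e\<alpha>' h)
    show "\<alpha>' (x \<cdot>\<^bsub>Y\<^esub> y) (x \<cdot>\<^bsub>Y\<^esub> z) (\<alpha> x y s t) (\<alpha> x z s u) =
        \<alpha> (y \<Colon>\<^bsub>Y\<^esub> x) (y \<Colon>\<^bsub>Y\<^esub> z) (\<alpha>' y x t s) (\<alpha>' y z t u)"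
      using X.q3[OF q(4-6)] Y.q3[OF q(1-3)]
      unfolding \<alpha>'_def[of "x \<cdot>\<^bsub>Y\<^esub> y" "x \<cdot>\<^bsub>Y\<^esub> z"] \<alpha>_def[of "y \<Colon>\<^bsub>Y\<^esub> x" "y \<Colon>\<^bsub>Y\<^esub> z"]
      by (simp add: e\<alpha> e\<alpha>' h)
  qed
  have "bij_betw (\<lambda>a. (f a, b (f a) a)) (carrier X) (carrier Y \<times> S)"
  proof (rule bij_betw_byWitness[where f' = "\<lambda>(y, s). e y s"])
    show "\<forall>p\<in>carrier Y \<times> S. (\<lambda>a. (f a, b (f a) a)) ((\<lambda>(y, s). e y s) p) = p"
    proof clarsimp
      fix y s assume h: "y \<in> carrier Y" "s \<in> S"
      have "b y (e y s) = s"
        unfolding e_def using b[OF h(1)] h(2) by (simp add: bij_betw_def f_inv_into_f)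
      then show "f (e y s) = y \<and> b (f (e y s)) (e y s) = s" using e(2)[OF h] by simp
    qed
  qed (use eb bS fD(2) e(1) in auto)
  then have "(\<lambda>a. (f a, b (f a) a)) \<in> q_cycle_iso X (dynamical_extension Y S \<alpha> \<alpha>')"
    by (simp add: q_cycle_iso_def dynamical_extension_def fD \<alpha>_def \<alpha>'_def eb)
  then show ?thesis using pair unfolding q_cycle_isomorphic_def by blast
qed

theorem theorem2p8:
  fixes X :: "'a qcycle_struct"
  assumes "finite (carrier X)"
    and "square_free_q_cycle_set X"
    and "indecomposable X"
    and "card (carrier X) > 1"
  shows "\<exists>(S :: 'a set) (Y :: 'a qcycle_struct) \<alpha> \<alpha>'.
           finite (carrier Y) \<and> square_free_q_cycle_set Y \<and> irretractable Y \<and>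
           dynamical_pair Y S \<alpha> \<alpha>' \<and> X \<cong>\<^sub>q dynamical_extension Y S \<alpha> \<alpha>'"
proof -
  interpret X: square_free_q_cycle_set X by (rule assms(2))
  let ?P = "\<lambda>Y :: 'a qcycle_struct. q_cycle_epi X Y \<noteq> {} \<and> card (carrier Y) > 1"
  have "?P X" using q_cycle_epi_id assms(4) by blast
  then obtain Y where "?P Y"
    and minimal: "\<And>Z. ?P Z \<Longrightarrow> card (carrier Y) \<le> card (carrier Z)"
    using ex_has_least_nat[of ?P X "\<lambda>Y. card (carrier Y)"] by blast
  then obtain f where f: "f \<in> q_cycle_epi X Y" and card: "card (carrier Y) > 1" by blast
  have finY: "finite (carrier Y)" using card by (simp add: card_ge_0_finite)
  have sfY: "square_free_q_cycle_set Y"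
    by (rule square_free_epi_image[OF assms(2,1) f])
  interpret Y: square_free_q_cycle_set Y by (rule sfY)
  have irr: "irretractable Y"
    by (rule irretractable_of_minimal[OF assms(3) f finY sfY card]) (use minimal in blast)
  obtain x0 where x0: "x0 \<in> carrier X" using X.nonempty by blast
  define S where "S = {a \<in> carrier X. f a = f x0}"
  have "\<exists>g. bij_betw g {a \<in> carrier X. f a = y} S" if y: "y \<in> carrier Y" for y
  proof -
    obtain x where "x \<in> carrier X" "y = f x" using y q_cycle_epiD(1)[OF f] by (metis imageE)
    then have "card {a \<in> carrier X. f a = y} = card S"
      using indecomposable_fibres_equicardinal[OF assms(3) Y.regular_q_cycle_set_axioms f _ x0, of x]
      by (simp add: S_def)
    then show ?thesis
      using assms(1) by (intro finite_same_card_bij) (simp_all add: S_def)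
  qed
  then obtain b where "\<And>y. y \<in> carrier Y \<Longrightarrow> bij_betw (b y) {a \<in> carrier X. f a = y} S"
    by metis
  from dynamical_extension_of_equicardinal_fibres[OF X.q_cycle_set_axioms Y.q_cycle_set_axioms f this]
  show ?thesis using finY sfY irr by blast
qed

end
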